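(* Let $(W,S)$ be a Coxeter system. Let $w\in W$ be a fully commutative element such that $w\neq 1$. Then $w$ has the ancestor property, i.e. there is a unique non-trivial involution of maximal length in the set $[1,w]=\{x\in W\mid x\leq_R w\}$.
   Context: A Coxeter matrix on a set $S$ is a function $m:S\times S\to\mathbb{N}\cup\{\infty\}$ with $m(r,s)=m(s,r)$, $m(r,s)=1$ if and only if $r=s$, and $m(r,s)\in\mathbb{N}_{\geq 2}\cup\{\infty\}$ for $r\neq s$. A Coxeter system is a pair $(W,S)$ where $W$ is a group, $S\subseteq W$, and $W\cong\langle s\in S\mid (rs)^{m(r,s)}=1 \text{ for all } r,s\in S\rangle$ (via the identity on $S$) for a Coxeter matrix $m$, relations with $m(r,s)=\infty$ being omitted. $S$ is not assumed finite. $\ell$ denotes the length function with respect to $S$; a reduced expression for $w$ is a sequence $(s_1,\dots,s_n)$ in $S$ with $w=s_1\cdots s_n$ and $n=\ell(w)$. The weak right order $\leq_R$ is defined by $x\leq_R w$ if and only if $\ell(w)=\ell(x)+\ell(x^{-1}w)$ (equivalently, some reduced expression for $x$ is a prefix of some reduced expression for $w$). An element $w$ is fully commutative if any reduced expression for $w$ can be obtained from any other by means of braid relations that only involve commuting generators (i.e. by successively swapping adjacent entries $r,s$ with $m(r,s)=2$). A non-trivial involution is an element $x\ne 1$ with $x^2=1$. An element $w\in W$ has the ancestor property if there is exactly one element of $[1,w]$ that is a non-trivial involution of maximal length among the non-trivial involutions in $[1,w]$. *)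

theory Defs
  imports "HOL-Algebra.Group" "HOL-Library.Extended_Nat"
begin

text \<open>A word over \<open>X \<union> X\<^sup>-\<^sup>1\<close> is a list of signed letters; \<open>(x, False)\<close> stands for the formal
  inverse of \<open>x\<close>.  The group \<open>\<langle>X | R\<rangle>\<close> consists of the words modulo the congruence generated by
  free cancellation and by deletion of relators.\<close>

type_synonym 'g signed_word = "('g \<times> bool) list"

inductive_set pres_cong :: "'g set \<Rightarrow> 'g signed_word set \<Rightarrow> ('g signed_word \<times> 'g signed_word) set"
  for X :: "'g set" and R :: "'g signed_word set"
where
  refl: "u \<in> lists (X \<times> UNIV) \<Longrightarrow> (u, u) \<in> pres_cong X R"
| sym: "(u, v) \<in> pres_cong X R \<Longrightarrow> (v, u) \<in> pres_cong X R"
| trans: "(u, v) \<in> pres_cong X R \<Longrightarrow> (v, w) \<in> pres_cong X R \<Longrightarrow> (u, w) \<in> pres_cong X R"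
| cancel: "u \<in> lists (X \<times> UNIV) \<Longrightarrow> v \<in> lists (X \<times> UNIV) \<Longrightarrow> x \<in> X \<Longrightarrow>
    (u @ [(x, b), (x, \<not> b)] @ v, u @ v) \<in> pres_cong X R"
| relator: "u \<in> lists (X \<times> UNIV) \<Longrightarrow> v \<in> lists (X \<times> UNIV) \<Longrightarrow>
    r \<in> R \<Longrightarrow> r \<in> lists (X \<times> UNIV) \<Longrightarrow> (u @ r @ v, u @ v) \<in> pres_cong X R"

definition presented_group :: "'g set \<Rightarrow> 'g signed_word set \<Rightarrow> 'g signed_word set monoid" where
  "presented_group X R =
    \<lparr> carrier = lists (X \<times> UNIV) // pres_cong X R,
      mult = (\<lambda>A B. \<Union>a\<in>A. \<Union>b\<in>B. pres_cong X R `` {a @ b}),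
      one = pres_cong X R `` {[]} \<rparr>"

definition coxeter_matrix :: "'a set \<Rightarrow> ('a \<Rightarrow> 'a \<Rightarrow> enat) \<Rightarrow> bool" where
  "coxeter_matrix S m \<longleftrightarrow>
    (\<forall>r\<in>S. \<forall>s\<in>S. m r s = m s r \<and> (m r s = 1 \<longleftrightarrow> r = s) \<and> (r \<noteq> s \<longrightarrow> 2 \<le> m r s))"

definition coxeter_relators :: "'a set \<Rightarrow> ('a \<Rightarrow> 'a \<Rightarrow> enat) \<Rightarrow> 'a signed_word set" where
  "coxeter_relators S m =
    {concat (replicate n [(r, True), (s, True)]) | r s n. r \<in> S \<and> s \<in> S \<and> m r s = enat n}"

text \<open>The last condition says that the inclusion of \<open>S\<close> into \<open>W\<close> induces an isomorphism
  \<open>\<langle>S | (rs)\<^bsup>m(r,s)\<^esup> = 1\<rangle> \<cong> W\<close>.\<close>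

definition coxeter_system ::
  "('a, 'b) monoid_scheme \<Rightarrow> 'a set \<Rightarrow> ('a \<Rightarrow> 'a \<Rightarrow> enat) \<Rightarrow> bool" where
  "coxeter_system W S m \<longleftrightarrow>
    group W \<and> S \<subseteq> carrier W \<and> coxeter_matrix S m \<and>
    (\<exists>\<phi> \<in> iso (presented_group S (coxeter_relators S m)) W.
      \<forall>s\<in>S. \<phi> (pres_cong S (coxeter_relators S m) `` {[(s, True)]}) = s)"

definition word_prod :: "('a, 'b) monoid_scheme \<Rightarrow> 'a list \<Rightarrow> 'a" where
  "word_prod W ss = foldr (mult W) ss (one W)"

text \<open>Words in \<open>S\<close> alone suffice here, since the elements of \<open>S\<close> are involutions.\<close>

definition cox_length :: "('a, 'b) monoid_scheme \<Rightarrow> 'a set \<Rightarrow> 'a \<Rightarrow> nat" where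
  "cox_length W S w = (LEAST n. \<exists>ss \<in> lists S. length ss = n \<and> word_prod W ss = w)"

definition reduced_expressions :: "('a, 'b) monoid_scheme \<Rightarrow> 'a set \<Rightarrow> 'a \<Rightarrow> 'a list set" where
  "reduced_expressions W S w =
    {ss \<in> lists S. word_prod W ss = w \<and> length ss = cox_length W S w}"

definition weak_right_le :: "('a, 'b) monoid_scheme \<Rightarrow> 'a set \<Rightarrow> 'a \<Rightarrow> 'a \<Rightarrow> bool" where
  "weak_right_le W S x w \<longleftrightarrow>
    cox_length W S w = cox_length W S x + cox_length W S (inv\<^bsub>W\<^esub> x \<otimes>\<^bsub>W\<^esub> w)"

text \<open>This is \<open>[1, w]\<close>; the lower bound \<open>1 \<le>\<^sub>R x\<close> holds for every \<open>x\<close>.\<close>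

definition weak_interval :: "('a, 'b) monoid_scheme \<Rightarrow> 'a set \<Rightarrow> 'a \<Rightarrow> 'a set" where
  "weak_interval W S w = {x \<in> carrier W. weak_right_le W S x w}"

definition commutation_moves :: "'a set \<Rightarrow> ('a \<Rightarrow> 'a \<Rightarrow> enat) \<Rightarrow> ('a list \<times> 'a list) set" where
  "commutation_moves S m =
    {(u @ [r, s] @ v, u @ [s, r] @ v) | u v r s. r \<in> S \<and> s \<in> S \<and> m r s = 2}"

definition fully_commutative ::
  "('a, 'b) monoid_scheme \<Rightarrow> 'a set \<Rightarrow> ('a \<Rightarrow> 'a \<Rightarrow> enat) \<Rightarrow> 'a \<Rightarrow> bool" where
  "fully_commutative W S m w \<longleftrightarrow>
    (\<forall>ss \<in> reduced_expressions W S w. \<forall>ts \<in> reduced_expressions W S w.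
      (ss, ts) \<in> (commutation_moves S m)\<^sup>*)"

definition nontrivial_involution :: "('a, 'b) monoid_scheme \<Rightarrow> 'a \<Rightarrow> bool" where
  "nontrivial_involution W x \<longleftrightarrow> x \<in> carrier W \<and> x \<noteq> \<one>\<^bsub>W\<^esub> \<and> x \<otimes>\<^bsub>W\<^esub> x = \<one>\<^bsub>W\<^esub>"

definition ancestor_property :: "('a, 'b) monoid_scheme \<Rightarrow> 'a set \<Rightarrow> 'a \<Rightarrow> bool" where
  "ancestor_property W S w \<longleftrightarrow>
    (\<exists>!x. x \<in> weak_interval W S w \<and> nontrivial_involution W x \<and>
      (\<forall>y \<in> weak_interval W S w. nontrivial_involution W y \<longrightarrow>
        cox_length W S y \<le> cox_length W S x))"

end

theory Submission
  imports Defs "HOL-Library.Sublist"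
begin

text \<open>
  Call two words trace equivalent if, for every pair of non-commuting letters \<open>s\<close>, \<open>t\<close>, their
  subwords on \<open>{s, t}\<close> coincide; all reduced words of a fully commutative \<open>w\<close> are trace equivalent.
  If \<open>u\<close> is a reduced word of an involution in \<open>[1, w]\<close> and \<open>u @ v\<close> one of \<open>w\<close>, then so is
  \<open>rev u @ v\<close>, and cancelling \<open>v\<close> shows that all the \<open>{s, t}\<close>-subwords of \<open>u\<close> are palindromes.
  Two elements of \<open>[1, w]\<close> have a join in \<open>[1, w]\<close>, whose \<open>{s, t}\<close>-subwords are the longer ones of
  the corresponding prefixes of the \<open>{s, t}\<close>-subword of \<open>w\<close>. The join of two involutions thus again
  has palindromic subwords, so it is an involution. Hence two distinct involutions of maximal
  length cannot exist.
\<close>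

section \<open>Trace equivalence of words\<close>

definition proj :: "'a \<Rightarrow> 'a \<Rightarrow> 'a list \<Rightarrow> 'a list" where
  "proj s t u = filter (\<lambda>x. x = s \<or> x = t) u"

text \<open>The projection criterion for equality in a partially commutative monoid, taken as the
  definition. Projections respect concatenation and reversal, so cancelling a factor and testing for
  palindromes are done pair by pair. For irreflexive \<open>C\<close> the case s = t is included and
  records letter counts.\<close>

definition trace_eq :: "('a \<Rightarrow> 'a \<Rightarrow> bool) \<Rightarrow> 'a list \<Rightarrow> 'a list \<Rightarrow> bool" where
  "trace_eq C u v \<longleftrightarrow> (\<forall>s t. \<not> C s t \<longrightarrow> proj s t u = proj s t v)"

lemma proj_simps [simp]:
  "proj s t [] = []"
  "proj s t (a # u) = (if a = s \<or> a = t then a # proj s t u else proj s t u)"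
  "proj s t (u @ v) = proj s t u @ proj s t v"
  "proj s t (rev u) = rev (proj s t u)"
  by (auto simp: proj_def rev_filter)

lemma proj_eq_Nil: "s \<notin> set u \<Longrightarrow> t \<notin> set u \<Longrightarrow> proj s t u = []"
  by (auto simp: proj_def filter_empty_conv)

lemma trace_eq_refl: "trace_eq C u u"
  by (simp add: trace_eq_def)

lemma trace_eq_sym: "trace_eq C u v \<Longrightarrow> trace_eq C v u"
  by (simp add: trace_eq_def)

lemma trace_eq_trans [trans]: "trace_eq C u v \<Longrightarrow> trace_eq C v w \<Longrightarrow> trace_eq C u w"
  by (simp add: trace_eq_def)

lemma trace_eq_set:
  assumes "trace_eq C u v" "irreflp C"
  shows "set u = set v"
proof -
  have "x \<in> set u \<longleftrightarrow> x \<in> set v" for x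
  proof -
    have "set (proj x x u) = set (proj x x v)"
      using assms by (simp add: trace_eq_def irreflp_def)
    then show ?thesis by (auto simp: proj_def)
  qed
  then show ?thesis by blast
qed

lemma trace_eq_length:
  assumes "trace_eq C u v" "irreflp C"
  shows "length u = length v"
proof -
  have "count_list u a = count_list v a" for a
  proof -
    have "length (proj a a u) = length (proj a a v)"
      using assms by (simp add: trace_eq_def irreflp_def)
    moreover have "(\<lambda>x. x = a) = (=) a" by auto
    ultimately show ?thesis by (simp add: proj_def count_list_eq_length_filter)
  qed
  then show ?thesis
    using trace_eq_set[OF assms] sum_count_set[of u "set u"] sum_count_set[of v "set u"] by simp
qed

text \<open>If some b in p did not commute with a, the subword on {a, b} would start with a on the
  left but with a letter of p on the right, and p contains no a. Deleting this a affects only pairs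
  containing a; for a non-commuting such pair p contributes nothing, so a heads both
  subwords.\<close>

lemma trace_eq_first:
  assumes eq: "trace_eq C (a # u) (p @ a # q)" and a: "a \<notin> set p"
    and sym: "symp C"
  shows "\<forall>b\<in>set p. C a b" and "trace_eq C u (p @ q)"
proof -
  show C: "\<forall>b\<in>set p. C a b"
  proof (rule ballI, rule ccontr)
    fix b assume b: "b \<in> set p" "\<not> C a b"
    then have "proj a b (a # u) = proj a b (p @ a # q)"
      using eq unfolding trace_eq_def by blast
    then have "a # proj a b u = proj a b p @ a # proj a b q" by simp
    moreover have "proj a b p \<noteq> []" using b by (auto simp: proj_def filter_empty_conv)
    ultimately have "a \<in> set (proj a b p)" by (cases "proj a b p") auto
    then show False using a by (simp add: proj_def)
  qed
  show "trace_eq C u (p @ q)"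
    unfolding trace_eq_def
  proof (intro allI impI)
    fix s t assume st: "\<not> C s t"
    have e: "proj s t (a # u) = proj s t (p @ a # q)" using eq st by (simp add: trace_eq_def)
    show "proj s t u = proj s t (p @ q)"
    proof (cases "a = s \<or> a = t")
      case True
      then have "proj s t p = []" using C st sympD[OF sym] a by (intro proj_eq_Nil) auto
      then show ?thesis using e True by simp
    qed (use e in auto)
  qed
qed

lemma trace_eq_move_front:
  assumes C: "\<forall>b\<in>set p. C a b" and a: "a \<notin> set p"
    and sym: "symp C"
  shows "trace_eq C (a # p @ q) (p @ a # q)"
  unfolding trace_eq_def
proof (intro allI impI)
  fix s t assume st: "\<not> C s t"
  show "proj s t (a # p @ q) = proj s t (p @ a # q)"
  proof (cases "a = s \<or> a = t")
    case True
    then have "proj s t p = []" using C st sympD[OF sym] a by (intro proj_eq_Nil) auto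
    then show ?thesis using True by simp
  qed auto
qed

lemma trace_eq_Cons: "trace_eq C u v \<Longrightarrow> trace_eq C (a # u) (a # v)"
  by (simp add: trace_eq_def)

text \<open>\<open>u1 @ c\<close> represents the join of two prefixes of the same trace. Both
  subwords are prefixes of one word, hence comparable: the first alternative says that the one of
  \<open>u1\<close> is the longer, the second that the one of \<open>u2\<close> is. The proof peels
  the first letter a off \<open>u2\<close> and looks for its first occurrence in
  \<open>u1 @ v1\<close>.\<close>

lemma trace_join:
  assumes "trace_eq C (u2 @ v2) (u1 @ v1)"
    and irr: "irreflp C" and sym: "symp C"
  shows "\<exists>c d. trace_eq C (u1 @ c @ d) (u1 @ v1) \<and>
    (\<forall>s t. \<not> C s t \<longrightarrow>
      proj s t (u1 @ c) = proj s t u1 \<and> prefix (proj s t u2) (proj s t u1) \<or>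
      proj s t (u1 @ c) = proj s t u2)"
  using assms(1)
proof (induction u2 arbitrary: u1 v1)
  case Nil
  show ?case
    by (rule exI[of _ "[]"], rule exI[of _ v1]) (auto simp: trace_eq_refl)
next
  case (Cons a u2)
  have eq: "trace_eq C (a # u2 @ v2) (u1 @ v1)" using Cons.prems by simp
  show ?case
  proof (cases "a \<in> set u1")
    case True
    then obtain p q where u1: "u1 = p @ a # q" and a: "a \<notin> set p"
      by (meson split_list_first)
    have eq': "trace_eq C (a # u2 @ v2) (p @ a # (q @ v1))" using eq u1 by simp
    note f = trace_eq_first[OF eq' a sym]
    \<comment> \<open>Here a lies in both prefixes, so it is deleted from both and later put back
      into \<open>u1\<close>; \<open>c\<close> and \<open>d\<close> stay the same.\<close>
    have "trace_eq C (u2 @ v2) ((p @ q) @ v1)" using f(2) by simp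
    from Cons.IH[OF this] obtain c d where
      cd: "trace_eq C ((p @ q) @ c @ d) ((p @ q) @ v1)" and
      pr: "\<And>s t. \<not> C s t \<Longrightarrow>
        proj s t ((p @ q) @ c) = proj s t (p @ q) \<and> prefix (proj s t u2) (proj s t (p @ q)) \<or>
        proj s t ((p @ q) @ c) = proj s t u2" by blast
    have "trace_eq C (p @ a # (q @ c @ d)) (a # p @ (q @ c @ d))"
      by (rule trace_eq_sym[OF trace_eq_move_front[OF f(1) a sym]])
    also have "trace_eq C \<dots> (a # p @ (q @ v1))"
      using trace_eq_Cons[OF cd] by simp
    also have "trace_eq C \<dots> (p @ a # (q @ v1))"
      by (rule trace_eq_move_front[OF f(1) a sym])
    finally have "trace_eq C (u1 @ c @ d) (u1 @ v1)" by (simp add: u1)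
    moreover have "proj s t (u1 @ c) = proj s t u1 \<and> prefix (proj s t (a # u2)) (proj s t u1) \<or>
        proj s t (u1 @ c) = proj s t (a # u2)" if st: "\<not> C s t" for s t
    proof (cases "a = s \<or> a = t")
      \<comment> \<open>As p contributes nothing, a heads the subwords of both \<open>u1\<close> and
        \<open>a # u2\<close>, and each alternative survives adding it.\<close>
      case True
      then have "proj s t p = []" using f(1) st sympD[OF sym] a by (intro proj_eq_Nil) auto
      then show ?thesis using pr[OF st] True by (auto simp: u1)
    qed (use pr[OF st] in \<open>auto simp: u1\<close>)
    ultimately show ?thesis by blast
  next
    case False
    have "a \<in> set (u1 @ v1)" using trace_eq_set[OF eq irr] by auto
    then obtain p q where v1: "v1 = p @ a # q" and ap: "a \<notin> set p"
      using False by (metis Un_iff set_append split_list_first)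
    have eq': "trace_eq C (a # u2 @ v2) ((u1 @ p) @ a # q)" using eq v1 by simp
    have a: "a \<notin> set (u1 @ p)" using False ap by simp
    note f = trace_eq_first[OF eq' a sym]
    \<comment> \<open>Since a commutes with all of \<open>u1\<close>, it may stand right after
      \<open>u1\<close>, as the first letter of the extension \<open>a # c\<close>.\<close>
    have f1: "\<forall>b\<in>set u1. C a b" using f(1) by simp
    have "trace_eq C (u2 @ v2) (u1 @ (p @ q))" using f(2) by simp
    from Cons.IH[OF this] obtain c d where
      cd: "trace_eq C (u1 @ c @ d) (u1 @ (p @ q))" and
      pr: "\<And>s t. \<not> C s t \<Longrightarrow>
        proj s t (u1 @ c) = proj s t u1 \<and> prefix (proj s t u2) (proj s t u1) \<or>
        proj s t (u1 @ c) = proj s t u2" by blast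
    have "trace_eq C (u1 @ a # (c @ d)) (a # u1 @ (c @ d))"
      by (rule trace_eq_sym[OF trace_eq_move_front[OF f1 False sym]])
    also have "trace_eq C \<dots> (a # (u1 @ p) @ q)"
      using trace_eq_Cons[OF cd] by simp
    also have "trace_eq C \<dots> ((u1 @ p) @ a # q)"
      by (rule trace_eq_move_front[OF f(1) a sym])
    finally have "trace_eq C (u1 @ (a # c) @ d) (u1 @ v1)" by (simp add: v1)
    moreover have "proj s t (u1 @ (a # c)) = proj s t u1 \<and>
          prefix (proj s t (a # u2)) (proj s t u1) \<or>
        proj s t (u1 @ (a # c)) = proj s t (a # u2)" if st: "\<not> C s t" for s t
    proof (cases "a = s \<or> a = t")
      \<comment> \<open>With an empty subword of \<open>u1\<close>, both alternatives of the
        induction hypothesis give \<open>c\<close> the same subword as \<open>u2\<close>; adding a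
        yields the second alternative.\<close>
      case True
      then have "proj s t u1 = []" using f1 st sympD[OF sym] False by (intro proj_eq_Nil) auto
      then show ?thesis using pr[OF st] True by auto
    qed (use pr[OF st] in auto)
    ultimately show ?thesis by blast
  qed
qed

section \<open>Words in a group\<close>

lemma word_prod_simps [simp]:
  "word_prod W [] = \<one>\<^bsub>W\<^esub>" "word_prod W (a # u) = a \<otimes>\<^bsub>W\<^esub> word_prod W u"
  by (simp_all add: word_prod_def)

context group
begin

lemma word_prod_closed [simp]: "set u \<subseteq> carrier G \<Longrightarrow> word_prod G u \<in> carrier G"
  by (induction u) auto

lemma word_prod_append:
  "set u \<subseteq> carrier G \<Longrightarrow> set v \<subseteq> carrier G \<Longrightarrow>
    word_prod G (u @ v) = word_prod G u \<otimes> word_prod G v"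
  by (induction u) (auto simp: m_assoc)

lemma word_prod_rev:
  assumes "set u \<subseteq> carrier G" "\<And>s. s \<in> set u \<Longrightarrow> s \<otimes> s = \<one>"
  shows "word_prod G (rev u) = inv (word_prod G u)"
  using assms
proof (induction u)
  case (Cons a u)
  have "inv a = a" using Cons.prems by (intro inv_equality) auto
  then show ?case
    using Cons by (simp add: word_prod_append inv_mult_group)
qed simp

lemma word_prod_move_front:
  assumes "set p \<subseteq> carrier G" "set q \<subseteq> carrier G" "a \<in> carrier G"
    and "\<forall>b\<in>set p. a \<otimes> b = b \<otimes> a"
  shows "word_prod G (p @ a # q) = a \<otimes> word_prod G (p @ q)"
  using assms
proof (induction p)
  case (Cons b p)
  have "word_prod G (p @ q) \<in> carrier G" using Cons.prems by simp
  then show ?case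
    using Cons by (simp flip: m_assoc)
qed simp

text \<open>By \<open>trace_eq_first\<close>, the first letter of u can be pulled to the front of v
  past letters commuting with it; induction handles the rest.\<close>

lemma word_prod_trace_eq:
  assumes "trace_eq C u v" "set u \<subseteq> carrier G"
    and irr: "irreflp C" and sym: "symp C"
    and comm: "\<And>s t. C s t \<Longrightarrow> s \<otimes> t = t \<otimes> s"
  shows "word_prod G u = word_prod G v"
  using assms(1,2)
proof (induction u arbitrary: v)
  case Nil
  then show ?case using trace_eq_length[OF Nil.prems(1) irr] by simp
next
  case (Cons a u)
  have "a \<in> set v" using trace_eq_set[OF Cons.prems(1) irr] by auto
  then obtain p q where v: "v = p @ a # q" and a: "a \<notin> set p" by (meson split_list_first)
  have sv: "set v \<subseteq> carrier G" using trace_eq_set[OF Cons.prems(1) irr] Cons.prems(2) by simp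
  note f = trace_eq_first[OF Cons.prems(1)[unfolded v] a sym]
  have "word_prod G u = word_prod G (p @ q)" using Cons.IH f(2) Cons.prems by simp
  then show ?case
    using word_prod_move_front[of p q a] sv f(1) comm by (simp add: v)
qed

end

section \<open>Coxeter systems\<close>

lemma pres_cong_lists:
  "(u, v) \<in> pres_cong X R \<Longrightarrow> u \<in> lists (X \<times> UNIV) \<and> v \<in> lists (X \<times> UNIV)"
  by (induction rule: pres_cong.induct) auto

lemma pres_cong_context:
  assumes "(u, v) \<in> pres_cong X R" "p \<in> lists (X \<times> UNIV)" "q \<in> lists (X \<times> UNIV)"
  shows "(p @ u @ q, p @ v @ q) \<in> pres_cong X R"
  using assms
proof (induction rule: pres_cong.induct)
  case (refl u)
  then show ?case by (auto intro!: pres_cong.refl)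
next
  case (sym u v)
  then show ?case by (auto intro: pres_cong.sym)
next
  case (trans u v w)
  then show ?case by (blast intro: pres_cong.trans)
next
  case (cancel u v x b)
  then show ?case using pres_cong.cancel[of "p @ u" X "v @ q" x b R] by simp
next
  case (relator u v r)
  then show ?case using pres_cong.relator[of "p @ u" X "v @ q" r R] by simp
qed

lemma pres_cong_append:
  assumes "(a, a') \<in> pres_cong X R" "(b, b') \<in> pres_cong X R"
  shows "(a @ b, a' @ b') \<in> pres_cong X R"
  using pres_cong_context[OF assms(1), of "[]" b] pres_cong_context[OF assms(2), of a' "[]"]
    pres_cong_lists[OF assms(1)] pres_cong_lists[OF assms(2)]
  by (auto intro: pres_cong.trans)

lemma pres_cong_class_eq:
  "(u, v) \<in> pres_cong X R \<Longrightarrow> pres_cong X R `` {u} = pres_cong X R `` {v}"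
  by (auto intro: pres_cong.trans pres_cong.sym)

text \<open>The product is a union over all representatives. The congruence makes the united classes
  coincide, and reflexivity makes the union nonempty.\<close>

lemma presented_group_mult:
  assumes "a \<in> lists (X \<times> UNIV)" "b \<in> lists (X \<times> UNIV)"
  shows "pres_cong X R `` {a} \<otimes>\<^bsub>presented_group X R\<^esub> pres_cong X R `` {b} = pres_cong X R `` {a @ b}"
proof -
  have "pres_cong X R `` {a' @ b'} = pres_cong X R `` {a @ b}"
    if "(a, a') \<in> pres_cong X R" "(b, b') \<in> pres_cong X R" for a' b'
    using pres_cong_class_eq[OF pres_cong_append[OF that]] by simp
  moreover have "(a, a) \<in> pres_cong X R" "(b, b) \<in> pres_cong X R"
    using assms by (auto intro: pres_cong.refl)
  ultimately have "(\<Union>a'\<in>pres_cong X R `` {a}. \<Union>b'\<in>pres_cong X R `` {b}. pres_cong X R `` {a' @ b'}) =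
      pres_cong X R `` {a @ b}"
    by blast
  then show ?thesis by (simp add: presented_group_def)
qed

lemma coxeter_system_facts:
  assumes "coxeter_system W S m"
  shows "\<And>s. s \<in> S \<Longrightarrow> s \<otimes>\<^bsub>W\<^esub> s = \<one>\<^bsub>W\<^esub>"
    and "\<And>s t. s \<in> S \<Longrightarrow> t \<in> S \<Longrightarrow> m s t = 2 \<Longrightarrow> s \<otimes>\<^bsub>W\<^esub> t = t \<otimes>\<^bsub>W\<^esub> s"
    and "\<And>w. w \<in> carrier W \<Longrightarrow> \<exists>u\<in>lists S. word_prod W u = w"
proof -
  let ?R = "coxeter_relators S m"
  let ?P = "presented_group S ?R"
  let ?c = "\<lambda>u. pres_cong S ?R `` {u}"
  from assms have "group W" and S: "S \<subseteq> carrier W" and cm: "coxeter_matrix S m"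
    by (auto simp: coxeter_system_def)
  interpret group W by fact
  obtain \<phi> where iso: "\<phi> \<in> iso ?P W" and \<phi>: "\<And>s. s \<in> S \<Longrightarrow> \<phi> (?c [(s, True)]) = s"
    using assms by (auto simp: coxeter_system_def)
  have car: "carrier ?P = lists (S \<times> UNIV) // pres_cong S ?R"
    by (simp add: presented_group_def)
  have mul: "\<phi> (?c (u @ v)) = \<phi> (?c u) \<otimes>\<^bsub>W\<^esub> \<phi> (?c v)"
    if "u \<in> lists (S \<times> UNIV)" "v \<in> lists (S \<times> UNIV)" for u v
    using iso that presented_group_mult[OF that, of ?R]
    by (metis (no_types, lifting) car hom_mult iso_imp_homomorphism quotientI)
  have clo: "\<phi> (?c u) \<in> carrier W" if "u \<in> lists (S \<times> UNIV)" for u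
    using iso that by (metis car hom_in_carrier iso_imp_homomorphism quotientI)
  \<comment> \<open>The empty word is its own square, and 1 is the only idempotent of a
    group.\<close>
  have one: "\<phi> (?c []) = \<one>\<^bsub>W\<^esub>"
    using mul[of "[]" "[]"] clo[of "[]"] by (simp add: l_cancel_one')
  have rel: "\<phi> (?c r) = \<one>\<^bsub>W\<^esub>" if "r \<in> ?R" "r \<in> lists (S \<times> UNIV)" for r
    using pres_cong_class_eq[OF pres_cong.relator[of "[]" S "[]" r ?R]] that one by simp
  show sq: "s \<otimes>\<^bsub>W\<^esub> s = \<one>\<^bsub>W\<^esub>" if s: "s \<in> S" for s
  proof -
    \<comment> \<open>The diagonal entry 1 supplies the relator ss.\<close>
    have "m s s = enat 1" using cm s by (simp add: coxeter_matrix_def one_enat_def)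
    then have "concat (replicate 1 [(s, True), (s, True)]) \<in> ?R"
      using s unfolding coxeter_relators_def by blast
    then have "\<phi> (?c ([(s, True)] @ [(s, True)])) = \<one>\<^bsub>W\<^esub>"
      using rel s by simp
    then show ?thesis using mul[of "[(s, True)]" "[(s, True)]"] \<phi> s by simp
  qed
  show "s \<otimes>\<^bsub>W\<^esub> t = t \<otimes>\<^bsub>W\<^esub> s" if st: "s \<in> S" "t \<in> S" "m s t = 2" for s t
  proof -
    have "m s t = enat 2" using st by (simp add: numeral_eq_enat)
    then have "concat (replicate 2 [(s, True), (t, True)]) \<in> ?R"
      using st unfolding coxeter_relators_def by blast
    then have "\<phi> (?c (([(s, True)] @ [(t, True)]) @ ([(s, True)] @ [(t, True)]))) = \<one>\<^bsub>W\<^esub>"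
      using rel st by (simp add: numeral_2_eq_2)
    then have "(s \<otimes>\<^bsub>W\<^esub> t) \<otimes>\<^bsub>W\<^esub> (s \<otimes>\<^bsub>W\<^esub> t) = \<one>\<^bsub>W\<^esub>"
      using mul[of "[(s, True)] @ [(t, True)]" "[(s, True)] @ [(t, True)]"]
        mul[of "[(s, True)]" "[(t, True)]"] \<phi> st by simp
    moreover have c: "s \<in> carrier W" "t \<in> carrier W" using st S by auto
    ultimately have "s \<otimes>\<^bsub>W\<^esub> t = inv\<^bsub>W\<^esub> (s \<otimes>\<^bsub>W\<^esub> t)" by (simp add: inv_equality)
    also have "\<dots> = t \<otimes>\<^bsub>W\<^esub> s"
      using c inv_equality[OF sq[OF st(1)]] inv_equality[OF sq[OF st(2)]]
      by (simp add: inv_mult_group)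
    finally show ?thesis .
  qed
  \<comment> \<open>The formal inverse of s is also sent to s, because s is an involution; this
    allows signs to be dropped by \<open>map fst\<close>.\<close>
  have inv_letter: "\<phi> (?c [(s, b)]) = s" if s: "s \<in> S" for s b
  proof (cases b)
    case False
    have "\<phi> (?c ([(s, True)] @ [(s, False)])) = \<one>\<^bsub>W\<^esub>"
      using pres_cong_class_eq[OF pres_cong.cancel[of "[]" S "[]" s True ?R]] s one by simp
    then have "s \<otimes>\<^bsub>W\<^esub> \<phi> (?c [(s, False)]) = s \<otimes>\<^bsub>W\<^esub> s"
      using mul[of "[(s, True)]" "[(s, False)]"] \<phi> sq s by simp
    then show ?thesis using False s S clo[of "[(s, False)]"] by auto
  qed (use \<phi> s in simp)
  have words: "\<phi> (?c u) = word_prod W (map fst u)" if "u \<in> lists (S \<times> UNIV)" for u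
    using that
  proof (induction u)
    case (Cons x u)
    then show ?case using mul[of "[x]" u] inv_letter[of "fst x" "snd x"] by auto
  qed (use one in simp)
  show "\<exists>u\<in>lists S. word_prod W u = w" if "w \<in> carrier W" for w
  proof -
    have "w \<in> \<phi> ` carrier ?P" using iso that by (auto simp: iso_def bij_betw_def)
    then obtain u where u: "u \<in> lists (S \<times> UNIV)" "w = \<phi> (?c u)"
      unfolding car by (auto elim!: quotientE)
    have "map fst u \<in> lists S" using u(1) by fastforce
    then show ?thesis using words[OF u(1)] u(2) by (intro bexI[of _ "map fst u"]) simp_all
  qed
qed

section \<open>Reduced words and the weak interval\<close>

lemma cox_length_le:
  "u \<in> lists S \<Longrightarrow> cox_length W S (word_prod W u) \<le> length u"
  unfolding cox_length_def by (rule Least_le) blast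

lemma reduced_expression_exists:
  assumes "coxeter_system W S m" "w \<in> carrier W"
  obtains u where "u \<in> reduced_expressions W S w"
proof -
  have "\<exists>n. \<exists>u\<in>lists S. length u = n \<and> word_prod W u = w"
    using coxeter_system_facts(3)[OF assms] by blast
  from LeastI_ex[OF this] show ?thesis
    using that unfolding reduced_expressions_def cox_length_def by blast
qed

text \<open>The reduced word of x is prescribed; a reduced word of the quotient is appended to it,
  and the lengths add up by definition of the weak order.\<close>

lemma weak_interval_word:
  assumes cs: "coxeter_system W S m" and w: "w \<in> carrier W"
    and x: "x \<in> weak_interval W S w" and u: "u \<in> reduced_expressions W S x"
  obtains v where "u @ v \<in> reduced_expressions W S w"
proof -
  interpret group W using cs by (simp add: coxeter_system_def)
  have S: "S \<subseteq> carrier W" using cs by (simp add: coxeter_system_def)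
  have xc: "x \<in> carrier W" and le: "weak_right_le W S x w"
    using x by (auto simp: weak_interval_def)
  obtain v where v: "v \<in> reduced_expressions W S (inv\<^bsub>W\<^esub> x \<otimes>\<^bsub>W\<^esub> w)"
    using reduced_expression_exists[OF cs] xc w by (metis inv_closed m_closed)
  have sets: "set u \<subseteq> carrier W" "set v \<subseteq> carrier W"
    using u v S by (auto simp: reduced_expressions_def)
  have "word_prod W (u @ v) = x \<otimes>\<^bsub>W\<^esub> (inv\<^bsub>W\<^esub> x \<otimes>\<^bsub>W\<^esub> w)"
    using u v sets by (simp add: word_prod_append reduced_expressions_def)
  also have "\<dots> = w" using xc w by (simp flip: m_assoc)
  finally show ?thesis
    using u v le that by (auto simp: reduced_expressions_def weak_right_le_def)
qed

text \<open>Replacing u and v by reduced words of their products gives another word for w. It cannot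
  be shorter than the length of w, so u and v were already reduced.\<close>

lemma reduced_prefix_weak_interval:
  assumes cs: "coxeter_system W S m" and uv: "u @ v \<in> reduced_expressions W S w"
  shows "u \<in> reduced_expressions W S (word_prod W u)"
    and "word_prod W u \<in> weak_interval W S w"
proof -
  interpret group W using cs by (simp add: coxeter_system_def)
  have S: "S \<subseteq> carrier W" using cs by (simp add: coxeter_system_def)
  have l: "u \<in> lists S" "v \<in> lists S" and w: "word_prod W (u @ v) = w"
    and len: "length u + length v = cox_length W S w"
    using uv by (auto simp: reduced_expressions_def)
  have sets: "set u \<subseteq> carrier W" "set v \<subseteq> carrier W" using l S by auto
  have v: "word_prod W v = inv\<^bsub>W\<^esub> (word_prod W u) \<otimes>\<^bsub>W\<^esub> w"
    using sets by (simp add: word_prod_append flip: w m_assoc)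
  obtain u' where u': "u' \<in> reduced_expressions W S (word_prod W u)"
    using reduced_expression_exists[OF cs] sets word_prod_closed by metis
  obtain v' where v': "v' \<in> reduced_expressions W S (word_prod W v)"
    using reduced_expression_exists[OF cs] sets word_prod_closed by metis
  have "set u' \<subseteq> carrier W" "set v' \<subseteq> carrier W"
    using u' v' S by (auto simp: reduced_expressions_def)
  then have "word_prod W (u' @ v') = w"
    using u' v' w sets by (simp add: word_prod_append reduced_expressions_def)
  then have "cox_length W S w \<le> length (u' @ v')"
    using cox_length_le[of "u' @ v'" S W] u' v' by (simp add: reduced_expressions_def)
  then have "cox_length W S w \<le>
      cox_length W S (word_prod W u) + cox_length W S (word_prod W v)"
    using u' v' by (simp add: reduced_expressions_def)
  moreover note cox_length_le[OF l(1), of W] cox_length_le[OF l(2), of W]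
  ultimately have e: "cox_length W S (word_prod W u) = length u"
      "cox_length W S (word_prod W v) = length v"
    using len by linarith+
  then show "u \<in> reduced_expressions W S (word_prod W u)"
    using l by (simp add: reduced_expressions_def)
  show "word_prod W u \<in> weak_interval W S w"
    using e len v sets by (simp add: weak_interval_def weak_right_le_def)
qed

section \<open>Full commutativity and involutions\<close>

text \<open>Restricting to S makes the relation symmetric and irreflexive, as m is constrained only
  there. A letter does not count as commuting with itself, since \<open>m s s = 1\<close>.\<close>

definition cox_comm :: "'a set \<Rightarrow> ('a \<Rightarrow> 'a \<Rightarrow> enat) \<Rightarrow> 'a \<Rightarrow> 'a \<Rightarrow> bool" where
  "cox_comm S m s t \<longleftrightarrow> s \<in> S \<and> t \<in> S \<and> m s t = 2"

lemma cox_comm_irrefl: "coxeter_matrix S m \<Longrightarrow> irreflp (cox_comm S m)"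
  unfolding coxeter_matrix_def cox_comm_def irreflp_def by (metis one_eq_numeral_iff semiring_norm(85))

lemma cox_comm_sym: "coxeter_matrix S m \<Longrightarrow> symp (cox_comm S m)"
  unfolding coxeter_matrix_def cox_comm_def symp_def by metis

text \<open>Swapping adjacent r and s alters only the subword on {r, s}, and this pair commutes in
  either order.\<close>

lemma commutation_moves_trace_eq:
  assumes cm: "coxeter_matrix S m" and "(u, v) \<in> (commutation_moves S m)\<^sup>*"
  shows "trace_eq (cox_comm S m) u v"
  using assms(2)
proof (induction rule: rtrancl_induct)
  case base
  show ?case by (rule trace_eq_refl)
next
  case (step v v')
  then obtain p q r s where v: "v = p @ [r, s] @ q" "v' = p @ [s, r] @ q" and rs: "cox_comm S m r s"
    by (auto simp: commutation_moves_def cox_comm_def)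
  have "trace_eq (cox_comm S m) v v'"
    unfolding trace_eq_def
  proof (intro allI impI)
    fix x y assume "\<not> cox_comm S m x y"
    then show "proj x y v = proj x y v'"
      using rs sympD[OF cox_comm_sym[OF cm] rs] by (auto simp: v)
  qed
  with step.IH show ?case by (rule trace_eq_trans)
qed

lemma involution_word_palindromic:
  assumes cs: "coxeter_system W S m" and fc: "fully_commutative W S m w"
    and x: "nontrivial_involution W x"
    and u: "u \<in> reduced_expressions W S x" and uv: "u @ v \<in> reduced_expressions W S w"
  shows "trace_eq (cox_comm S m) u (rev u)"
proof -
  interpret group W using cs by (simp add: coxeter_system_def)
  have S: "S \<subseteq> carrier W" using cs by (simp add: coxeter_system_def)
  have l: "set u \<subseteq> carrier W" "set v \<subseteq> carrier W" "set u \<subseteq> S"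
    using S uv by (auto simp: reduced_expressions_def)
  have "word_prod W (rev u) = inv\<^bsub>W\<^esub> x"
    using word_prod_rev[OF l(1)] coxeter_system_facts(1)[OF cs] l(3) u
    by (auto simp: reduced_expressions_def)
  also have "\<dots> = word_prod W u"
    using x u by (auto simp: nontrivial_involution_def reduced_expressions_def inv_equality)
  finally have "rev u @ v \<in> reduced_expressions W S w"
    using uv l by (auto simp: reduced_expressions_def word_prod_append)
  then have "trace_eq (cox_comm S m) (u @ v) (rev u @ v)"
    using fc uv commutation_moves_trace_eq cs
    by (metis coxeter_system_def fully_commutative_def)
  then show ?thesis by (simp add: trace_eq_def)
qed

text \<open>Only x is assumed maximal: the join of x and y is an involution in [1, w] extending x,
  so the extension is empty. For two maximal involutions the lemma applies both ways and the
  subwords agree.\<close>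

lemma maximal_involution_prefix:
  assumes cs: "coxeter_system W S m" and w: "w \<in> carrier W" and fc: "fully_commutative W S m w"
    and x: "x \<in> weak_interval W S w" "nontrivial_involution W x"
    and y: "y \<in> weak_interval W S w" "nontrivial_involution W y"
    and max: "\<forall>z\<in>weak_interval W S w. nontrivial_involution W z \<longrightarrow>
      cox_length W S z \<le> cox_length W S x"
    and u1: "u1 \<in> reduced_expressions W S x" and u2: "u2 \<in> reduced_expressions W S y"
    and st: "\<not> cox_comm S m s t"
  shows "prefix (proj s t u2) (proj s t u1)"
proof -
  let ?C = "cox_comm S m"
  interpret group W using cs by (simp add: coxeter_system_def)
  have S: "S \<subseteq> carrier W" and cm: "coxeter_matrix S m" using cs by (auto simp: coxeter_system_def)
  note irr = cox_comm_irrefl[OF cm] and sym = cox_comm_sym[OF cm]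
  have comm: "\<And>s t. ?C s t \<Longrightarrow> s \<otimes>\<^bsub>W\<^esub> t = t \<otimes>\<^bsub>W\<^esub> s"
    using coxeter_system_facts(2)[OF cs] by (auto simp: cox_comm_def)
  obtain v1 where v1: "u1 @ v1 \<in> reduced_expressions W S w"
    using weak_interval_word[OF cs w x(1) u1] .
  obtain v2 where v2: "u2 @ v2 \<in> reduced_expressions W S w"
    using weak_interval_word[OF cs w y(1) u2] .
  have pal1: "trace_eq ?C u1 (rev u1)"
    by (rule involution_word_palindromic[OF cs fc x(2) u1 v1])
  have pal2: "trace_eq ?C u2 (rev u2)"
    by (rule involution_word_palindromic[OF cs fc y(2) u2 v2])
  have "trace_eq ?C (u2 @ v2) (u1 @ v1)"
    using fc v1 v2 commutation_moves_trace_eq[OF cm] by (metis fully_commutative_def)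
  from trace_join[OF this irr sym] obtain c d where
    cd: "trace_eq ?C (u1 @ c @ d) (u1 @ v1)" and
    pr: "\<And>s t. \<not> ?C s t \<Longrightarrow>
      proj s t (u1 @ c) = proj s t u1 \<and> prefix (proj s t u2) (proj s t u1) \<or>
      proj s t (u1 @ c) = proj s t u2" by blast
  let ?z = "word_prod W (u1 @ c)"
  have set_cd: "set (u1 @ c @ d) \<subseteq> S"
    using trace_eq_set[OF cd irr] v1 by (auto simp: reduced_expressions_def)
  then have c: "set (u1 @ c @ d) \<subseteq> carrier W" "set (u1 @ c) \<subseteq> carrier W" using S by auto
  \<comment> \<open>Trace equivalence with \<open>u1 @ v1\<close> preserves both product and
    length.\<close>
  have "(u1 @ c) @ d \<in> reduced_expressions W S w"
    using v1 trace_eq_length[OF cd irr] set_cd word_prod_trace_eq[OF cd c(1) irr sym comm]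
    by (auto simp: reduced_expressions_def)
  note red = reduced_prefix_weak_interval[OF cs this]
  have "trace_eq ?C (u1 @ c) (rev (u1 @ c))"
    unfolding trace_eq_def
  proof (intro allI impI)
    fix s t assume st: "\<not> ?C s t"
    have "rev (proj s t u1) = proj s t u1" "rev (proj s t u2) = proj s t u2"
      using pal1 pal2 st by (simp_all add: trace_eq_def)
    \<comment> \<open>By either alternative this subword is one of \<open>u1\<close> or of
      \<open>u2\<close>, hence a palindrome.\<close>
    then have "rev (proj s t (u1 @ c)) = proj s t (u1 @ c)" using pr[OF st] by metis
    then show "proj s t (u1 @ c) = proj s t (rev (u1 @ c))" by (simp only: proj_simps)
  qed
  from word_prod_trace_eq[OF this c(2) irr sym comm]
  have "?z = inv\<^bsub>W\<^esub> ?z"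
    using word_prod_rev[OF c(2)] coxeter_system_facts(1)[OF cs] set_cd by auto
  then have "?z \<otimes>\<^bsub>W\<^esub> ?z = \<one>\<^bsub>W\<^esub>" using c(2) by (metis r_inv word_prod_closed)
  moreover have "?z \<noteq> \<one>\<^bsub>W\<^esub>"
  proof
    assume "?z = \<one>\<^bsub>W\<^esub>"
    \<comment> \<open>The reduced word \<open>u1 @ c\<close> would be empty, forcing x = 1.\<close>
    then have "cox_length W S ?z = 0"
      using cox_length_le[of "[]" S W] by simp
    then have "u1 = []" using red(1) by (simp add: reduced_expressions_def)
    then show False using u1 x(2) by (auto simp: reduced_expressions_def nontrivial_involution_def)
  qed
  ultimately have "cox_length W S ?z \<le> cox_length W S x"
    using max red(2) c(2) by (simp add: nontrivial_involution_def)
  then have "length (u1 @ c) \<le> length u1"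
    using red(1) u1 by (simp add: reduced_expressions_def)
  then have "c = []" by simp
  \<comment> \<open>With \<open>c\<close> empty, the second alternative is equality of the two
    subwords.\<close>
  then show ?thesis using pr[OF st] by auto
qed

theorem theorem1p2:
  fixes W :: "('a, 'b) monoid_scheme"
    and S :: "'a set"
    and m :: "'a \<Rightarrow> 'a \<Rightarrow> enat"
    and w :: 'a
  assumes "coxeter_system W S m"
    and "w \<in> carrier W"
    and "fully_commutative W S m w"
    and "w \<noteq> \<one>\<^bsub>W\<^esub>"
  shows "ancestor_property W S w"
proof -
  note cs = assms(1) and w = assms(2) and fc = assms(3)
  interpret group W using cs by (simp add: coxeter_system_def)
  have S: "S \<subseteq> carrier W" and cm: "coxeter_matrix S m" using cs by (auto simp: coxeter_system_def)
  let ?I = "\<lambda>x. x \<in> weak_interval W S w \<and> nontrivial_involution W x"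
  let ?M = "\<lambda>x. x \<in> weak_interval W S w \<and> nontrivial_involution W x \<and>
    (\<forall>y\<in>weak_interval W S w. nontrivial_involution W y \<longrightarrow>
      cox_length W S y \<le> cox_length W S x)"
  obtain ss where ss: "ss \<in> reduced_expressions W S w"
    using reduced_expression_exists[OF cs w] .
  \<comment> \<open>For existence, the first letter of a reduced word of w is a nontrivial
    involution in [1, w].\<close>
  have "ss \<noteq> []" using ss assms(4) by (auto simp: reduced_expressions_def)
  then obtain a r where "ss = [a] @ r" by (cases ss) auto
  with ss have ar: "[a] @ r \<in> reduced_expressions W S w" by simp
  have a: "a \<in> S" using ar by (simp add: reduced_expressions_def)
  then have ac: "a \<in> carrier W" using S by blast
  note ra = reduced_prefix_weak_interval[OF cs ar]
  have "a \<noteq> \<one>\<^bsub>W\<^esub>"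
    using ra(1) cox_length_le[of "[]" S W] by (auto simp: reduced_expressions_def)
  then have "?I a"
    using ra(2) ac coxeter_system_facts(1)[OF cs a] by (simp add: nontrivial_involution_def)
  \<comment> \<open>Lengths in [1, w] are bounded by that of w, so a maximum is attained;
    \<open>Suc\<close> turns this into the strict bound required by the rule.\<close>
  moreover have "\<forall>y. ?I y \<longrightarrow> cox_length W S y < Suc (cox_length W S w)"
    by (simp add: weak_interval_def weak_right_le_def)
  ultimately have "\<exists>x. ?I x \<and> (\<forall>y. ?I y \<longrightarrow> cox_length W S y \<le> cox_length W S x)"
    by (rule Lattices_Big.ex_has_greatest_nat)
  then obtain x where x: "?M x" by blast
  have unique: "y = x" if y: "?M y" for y
  proof -
    obtain u1 where u1: "u1 \<in> reduced_expressions W S x"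
      using reduced_expression_exists[OF cs] x by (auto simp: weak_interval_def)
    obtain u2 where u2: "u2 \<in> reduced_expressions W S y"
      using reduced_expression_exists[OF cs] y by (auto simp: weak_interval_def)
    \<comment> \<open>Both elements are maximal, so each subword is a prefix of the other.\<close>
    have "trace_eq (cox_comm S m) u1 u2"
      unfolding trace_eq_def
    proof (intro allI impI)
      fix s t assume st: "\<not> cox_comm S m s t"
      show "proj s t u1 = proj s t u2"
        using maximal_involution_prefix[OF cs w fc _ _ _ _ _ u1 u2 st]
          maximal_involution_prefix[OF cs w fc _ _ _ _ _ u2 u1 st] x y
        by (blast intro: prefix_order.antisym)
    qed
    then have "word_prod W u1 = word_prod W u2"
      using u1 S cox_comm_irrefl[OF cm] cox_comm_sym[OF cm] coxeter_system_facts(2)[OF cs]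
      by (intro word_prod_trace_eq[of "cox_comm S m"])
        (auto simp: reduced_expressions_def cox_comm_def)
    then show ?thesis using u1 u2 by (simp add: reduced_expressions_def)
  qed
  show ?thesis
    unfolding ancestor_property_def by (rule ex1I[of ?M x]) (fact x, fact unique)
qed

end
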